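(* Let $(R,\varepsilon,V,\beta)$ be Frobenius quantum data, let $n\ge 1$ and let $H_n=V^{\otimes_R n}$. Then for all $a,b\in H_n$ the operators $T_a$ and $M_b$ on $\mathrm{Fun}(H_n,\mathbb{C})$ satisfy $$T_aM_b=\varepsilon(\beta(b,a))^{-1}\,M_bT_a,$$ where $\beta$ on $H_n$ denotes the bilinear form induced monoidally on $H_n$ from the form $\beta$ on $V$.
   Context: Frobenius quantum data $(R,\varepsilon,V,\beta)$ consist of a finite commutative Frobenius ring $R$ with generating character $\varepsilon:(R,+)\to\mathbb{C}^\times$, a finite free $R$-module $V$ of rank $k$, and a perfect $R$-bilinear form $\beta:V\times V\to R$. Here a finite commutative ring $R$ is Frobenius with generating character $\varepsilon$ if $\varepsilon$ is an additive character such that $x\mapsto(y\mapsto\varepsilon(xy))$ is an isomorphism $R\to\widehat R$ of $R$-modules, where $\widehat R$ is the group of additive characters of $R$; and $\beta$ is perfect if the induced maps $V\to\mathrm{Hom}_R(V,R)$ are isomorphisms. The phase pairing on $V$ is $\langle v,w\rangle_V=\varepsilon(\beta(v,w))$. It is extended to $H_n=V^{\otimes_R n}$ by setting, for pure tensors $v=v_1\otimes\cdots\otimes v_n$ and $w=w_1\otimes\cdots\otimes w_n$, $\langle v,w\rangle_{H_n}=\prod_{i=1}^n\langle v_i,w_i\rangle_V=\varepsilon\big(\sum_{i=1}^n\beta(v_i,w_i)\big)$. The symbol $\beta$ is also used for the bilinear form on $H_n$ induced monoidally (by tensor extension) from $\beta$, and $\varepsilon(\beta(y,u))$ for $y,u\in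 H_n$ is the phase pairing on $H_n$. $\mathrm{Fun}(H_n,\mathbb{C})$ is the space of functions $H_n\to\mathbb{C}$. For $a,b\in H_n$ the shift and phase operators are $(T_af)(x)=f(x-a)$ and $(M_bf)(x)=\varepsilon(\beta(b,x))\,f(x)$.
   Formalization: The form on H_n is the tensor-product bilinear form, with value ∏β(v_i,w_i) on pure tensors; the displayed phase pairing ε(∑β(v_i,w_i)) is not well defined on V^{⊗n} for n≥2 (e.g. 1⊗0=0⊗0 over F_2 gets two values), so it is not used. *)

theory Defs
  imports Complex_Main "HOL-Algebra.Module" "HOL-Algebra.AbelCoset"
begin

section \<open>Modules over a commutative ring\<close>

text \<open>
  A record of type \<^typ>\<open>('r, 'm) module\<close> extends the ring record. When it is only used as a
  module, its fields \<^term>\<open>mult\<close> and \<^term>\<open>one\<close> carry no information; they are left undefined.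
\<close>

definition mod_hom ::
    "('r, 'x) ring_scheme \<Rightarrow> ('r, 'a, 'y) module_scheme \<Rightarrow> ('r, 'b, 'z) module_scheme \<Rightarrow> ('a \<Rightarrow> 'b) set"
  where "mod_hom R M N =
    {f \<in> carrier M \<rightarrow> carrier N.
       (\<forall>x\<in>carrier M. \<forall>y\<in>carrier M. f (x \<oplus>\<^bsub>M\<^esub> y) = f x \<oplus>\<^bsub>N\<^esub> f y) \<and>
       (\<forall>r\<in>carrier R. \<forall>x\<in>carrier M. f (r \<odot>\<^bsub>M\<^esub> x) = r \<odot>\<^bsub>N\<^esub> f x)}"

definition mod_iso ::
    "('r, 'x) ring_scheme \<Rightarrow> ('r, 'a, 'y) module_scheme \<Rightarrow> ('r, 'b, 'z) module_scheme \<Rightarrow> ('a \<Rightarrow> 'b) set"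
  where "mod_iso R M N = {f \<in> mod_hom R M N. bij_betw f (carrier M) (carrier N)}"

definition regular_module :: "('r, 'x) ring_scheme \<Rightarrow> ('r, 'r) module"
  where "regular_module R =
    \<lparr>carrier = carrier R, mult = mult R, one = one R, zero = zero R, add = add R, smult = mult R\<rparr>"

definition hom_module ::
    "('r, 'x) ring_scheme \<Rightarrow> ('r, 'a, 'y) module_scheme \<Rightarrow> ('r, 'b, 'z) module_scheme \<Rightarrow> ('r, 'a \<Rightarrow> 'b) module"
  where "hom_module R M N =
    \<lparr>carrier = mod_hom R M N \<inter> extensional (carrier M), mult = undefined, one = undefined,
     zero = (\<lambda>x\<in>carrier M. \<zero>\<^bsub>N\<^esub>), add = (\<lambda>f g. \<lambda>x\<in>carrier M. f x \<oplus>\<^bsub>N\<^esub> g x),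
     smult = (\<lambda>r f. \<lambda>x\<in>carrier M. r \<odot>\<^bsub>N\<^esub> f x)\<rparr>"

definition free_of_rank :: "('r, 'x) ring_scheme \<Rightarrow> ('r, 'v, 'y) module_scheme \<Rightarrow> nat \<Rightarrow> bool"
  where "free_of_rank R V k \<longleftrightarrow>
    (\<exists>e \<in> {..<k} \<rightarrow> carrier V. \<forall>v\<in>carrier V.
       \<exists>!c. c \<in> {..<k} \<rightarrow>\<^sub>E carrier R \<and> v = finsum V (\<lambda>i. c i \<odot>\<^bsub>V\<^esub> e i) {..<k})"

definition bilinear_form ::
    "('r, 'x) ring_scheme \<Rightarrow> ('r, 'v, 'y) module_scheme \<Rightarrow> ('v \<Rightarrow> 'v \<Rightarrow> 'r) \<Rightarrow> bool"
  where "bilinear_form R V \<beta> \<longleftrightarrow>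
    (\<forall>v\<in>carrier V. (\<lambda>w. \<beta> v w) \<in> mod_hom R V (regular_module R)) \<and>
    (\<forall>w\<in>carrier V. (\<lambda>v. \<beta> v w) \<in> mod_hom R V (regular_module R))"

definition perfect_form ::
    "('r, 'x) ring_scheme \<Rightarrow> ('r, 'v, 'y) module_scheme \<Rightarrow> ('v \<Rightarrow> 'v \<Rightarrow> 'r) \<Rightarrow> bool"
  where "perfect_form R V \<beta> \<longleftrightarrow> bilinear_form R V \<beta> \<and>
    (\<lambda>v. \<lambda>w\<in>carrier V. \<beta> v w) \<in> mod_iso R V (hom_module R V (regular_module R)) \<and>
    (\<lambda>w. \<lambda>v\<in>carrier V. \<beta> v w) \<in> mod_iso R V (hom_module R V (regular_module R))"


section \<open>Frobenius quantum data\<close>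

definition additive_character :: "('r, 'x) ring_scheme \<Rightarrow> ('r \<Rightarrow> complex) \<Rightarrow> bool"
  where "additive_character R \<chi> \<longleftrightarrow>
    (\<forall>x\<in>carrier R. \<chi> x \<noteq> 0) \<and>
    (\<forall>x\<in>carrier R. \<forall>y\<in>carrier R. \<chi> (x \<oplus>\<^bsub>R\<^esub> y) = \<chi> x * \<chi> y)"

text \<open>
  The group of additive characters is written multiplicatively in the complex numbers, so
  pointwise multiplication is the addition of the module.
\<close>

definition character_module :: "('r, 'x) ring_scheme \<Rightarrow> ('r, 'r \<Rightarrow> complex) module"
  where "character_module R =
    \<lparr>carrier = {\<chi> \<in> extensional (carrier R). additive_character R \<chi>},
     mult = undefined, one = undefined,
     zero = (\<lambda>y\<in>carrier R. 1), add = (\<lambda>\<chi> \<psi>. \<lambda>y\<in>carrier R. \<chi> y * \<psi> y),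
     smult = (\<lambda>r \<chi>. \<lambda>y\<in>carrier R. \<chi> (r \<otimes>\<^bsub>R\<^esub> y))\<rparr>"

definition generating_character :: "('r, 'x) ring_scheme \<Rightarrow> ('r \<Rightarrow> complex) \<Rightarrow> bool"
  where "generating_character R \<epsilon> \<longleftrightarrow> additive_character R \<epsilon> \<and>
    (\<lambda>x. \<lambda>y\<in>carrier R. \<epsilon> (x \<otimes>\<^bsub>R\<^esub> y)) \<in> mod_iso R (regular_module R) (character_module R)"

locale frobenius_quantum_data = module R V
  for R :: "('r, 'x) ring_scheme" (structure)
    and \<epsilon> :: "'r \<Rightarrow> complex"
    and V :: "('r, 'v, 'y) module_scheme" (structure)
    and k :: nat
    and \<beta> :: "'v \<Rightarrow> 'v \<Rightarrow> 'r" +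
  assumes finite_ring: "finite (carrier R)"
    and generating: "generating_character R \<epsilon>"
    and free: "free_of_rank R V k"
    and perfect: "perfect_form R V \<beta>"


section \<open>Tensor powers\<close>

definition free_module :: "('r, 'x) ring_scheme \<Rightarrow> 'i set \<Rightarrow> ('r, 'i \<Rightarrow> 'r) module"
  where "free_module R X =
    \<lparr>carrier = {f \<in> X \<rightarrow>\<^sub>E carrier R. finite {p\<in>X. f p \<noteq> \<zero>\<^bsub>R\<^esub>}},
     mult = undefined, one = undefined,
     zero = (\<lambda>p\<in>X. \<zero>\<^bsub>R\<^esub>), add = (\<lambda>f g. \<lambda>p\<in>X. f p \<oplus>\<^bsub>R\<^esub> g p),
     smult = (\<lambda>r f. \<lambda>p\<in>X. r \<otimes>\<^bsub>R\<^esub> f p)\<rparr>"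

definition free_gen :: "('r, 'x) ring_scheme \<Rightarrow> 'i set \<Rightarrow> 'i \<Rightarrow> 'i \<Rightarrow> 'r"
  where "free_gen R X q = (\<lambda>p\<in>X. if p = q then \<one>\<^bsub>R\<^esub> else \<zero>\<^bsub>R\<^esub>)"

definition submodule_generated ::
    "('r, 'x) ring_scheme \<Rightarrow> ('r, 'a, 'y) module_scheme \<Rightarrow> 'a set \<Rightarrow> 'a set"
  where "submodule_generated R M S = \<Inter>{N. submodule N R M \<and> S \<subseteq> N}"

definition quotient_module :: "('r, 'a, 'y) module_scheme \<Rightarrow> 'a set \<Rightarrow> ('r, 'a set) module"
  where "quotient_module M N =
    \<lparr>carrier = a_rcosets\<^bsub>M\<^esub> N, mult = undefined, one = undefined,
     zero = N, add = set_add M, smult = (\<lambda>r A. \<Union>x\<in>A. N +>\<^bsub>M\<^esub> (r \<odot>\<^bsub>M\<^esub> x))\<rparr>"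

definition tuples :: "('r, 'v, 'y) module_scheme \<Rightarrow> nat \<Rightarrow> (nat \<Rightarrow> 'v) set"
  where "tuples V n = {..<n} \<rightarrow>\<^sub>E carrier V"

definition multilinear_relations ::
    "('r, 'x) ring_scheme \<Rightarrow> ('r, 'v, 'y) module_scheme \<Rightarrow> nat \<Rightarrow> ((nat \<Rightarrow> 'v) \<Rightarrow> 'r) set"
  where "multilinear_relations R V n =
    (let F = free_module R (tuples V n); \<delta> = free_gen R (tuples V n) in
     {\<delta> (p(i := v \<oplus>\<^bsub>V\<^esub> w)) \<ominus>\<^bsub>F\<^esub> (\<delta> (p(i := v)) \<oplus>\<^bsub>F\<^esub> \<delta> (p(i := w))) | p i v w.
        p \<in> tuples V n \<and> i < n \<and> v \<in> carrier V \<and> w \<in> carrier V} \<union>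
     {\<delta> (p(i := r \<odot>\<^bsub>V\<^esub> v)) \<ominus>\<^bsub>F\<^esub> r \<odot>\<^bsub>F\<^esub> \<delta> (p(i := v)) | p i r v.
        p \<in> tuples V n \<and> i < n \<and> r \<in> carrier R \<and> v \<in> carrier V})"

definition tensor_kernel ::
    "('r, 'x) ring_scheme \<Rightarrow> ('r, 'v, 'y) module_scheme \<Rightarrow> nat \<Rightarrow> ((nat \<Rightarrow> 'v) \<Rightarrow> 'r) set"
  where "tensor_kernel R V n =
    submodule_generated R (free_module R (tuples V n)) (multilinear_relations R V n)"

definition tensor_power ::
    "('r, 'x) ring_scheme \<Rightarrow> ('r, 'v, 'y) module_scheme \<Rightarrow> nat \<Rightarrow> ('r, ((nat \<Rightarrow> 'v) \<Rightarrow> 'r) set) module"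
  where "tensor_power R V n = quotient_module (free_module R (tuples V n)) (tensor_kernel R V n)"

text \<open>
  The form induced on the tensor power is the bilinear form whose value on two pure tensors is the
  product of the values of \<open>\<beta>\<close> on the factors. (The sum of these values does not respect the relation
  \<open>rv \<otimes> w = v \<otimes> rw\<close> and defines no bilinear form on the tensor power.) It is first extended
  bilinearly to the free module on tuples and then evaluated on representatives of cosets, so
  that the set given to \<^const>\<open>the_elem\<close> is a singleton.
\<close>

definition free_form ::
    "('r, 'x) ring_scheme \<Rightarrow> ('r, 'v, 'y) module_scheme \<Rightarrow> ('v \<Rightarrow> 'v \<Rightarrow> 'r) \<Rightarrow> nat \<Rightarrow>
     ((nat \<Rightarrow> 'v) \<Rightarrow> 'r) \<Rightarrow> ((nat \<Rightarrow> 'v) \<Rightarrow> 'r) \<Rightarrow> 'r"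
  where "free_form R V \<beta> n f g =
    (\<Oplus>\<^bsub>R\<^esub>p\<in>{p \<in> tuples V n. f p \<noteq> \<zero>\<^bsub>R\<^esub>}. \<Oplus>\<^bsub>R\<^esub>q\<in>{q \<in> tuples V n. g q \<noteq> \<zero>\<^bsub>R\<^esub>}.
       f p \<otimes>\<^bsub>R\<^esub> g q \<otimes>\<^bsub>R\<^esub> (\<Otimes>\<^bsub>R\<^esub>i\<in>{..<n}. \<beta> (p i) (q i)))"

definition tensor_form ::
    "('r, 'x) ring_scheme \<Rightarrow> ('r, 'v, 'y) module_scheme \<Rightarrow> ('v \<Rightarrow> 'v \<Rightarrow> 'r) \<Rightarrow> nat \<Rightarrow>
     ((nat \<Rightarrow> 'v) \<Rightarrow> 'r) set \<Rightarrow> ((nat \<Rightarrow> 'v) \<Rightarrow> 'r) set \<Rightarrow> 'r"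
  where "tensor_form R V \<beta> n A B = the_elem ((\<lambda>(f, g). free_form R V \<beta> n f g) ` (A \<times> B))"


section \<open>Shift and phase operators\<close>

definition Fun :: "('h, 'z) partial_object_scheme \<Rightarrow> ('h \<Rightarrow> complex) set"
  where "Fun H = carrier H \<rightarrow>\<^sub>E UNIV"

definition shift_op :: "('h, 'z) ring_scheme \<Rightarrow> 'h \<Rightarrow> ('h \<Rightarrow> complex) \<Rightarrow> 'h \<Rightarrow> complex"
  where "shift_op H a f = (\<lambda>x\<in>carrier H. f (x \<ominus>\<^bsub>H\<^esub> a))"

definition phase_op ::
    "('h, 'z) ring_scheme \<Rightarrow> ('r \<Rightarrow> complex) \<Rightarrow> ('h \<Rightarrow> 'h \<Rightarrow> 'r) \<Rightarrow> 'h \<Rightarrow> ('h \<Rightarrow> complex) \<Rightarrow> 'h \<Rightarrow> complex"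
  where "phase_op H \<epsilon> \<beta> b f = (\<lambda>x\<in>carrier H. \<epsilon> (\<beta> b x) * f x)"

end

theory Submission
  imports Defs
begin

text \<open>
  The commutation relation is the identity
  \<open>\<epsilon> (\<beta>(b, x)) = \<epsilon> (\<beta>(b, x - a)) * \<epsilon> (\<beta>(b, a))\<close>, that is, additivity of the induced form in its second
  argument. The form on the free module is the linear extension, in each argument, of
  \<open>(p, q) \<mapsto> \<Prod>i<n. \<beta> (p i) (q i)\<close>. This function is multilinear in \<open>p\<close> and in \<open>q\<close>, so both extensions
  vanish on the multilinear relations, hence on the submodule generated by them, and the form
  descends to the quotient.
\<close>

section \<open>Submodules and quotients\<close>

context module
begin

lemma submodule_submodule_generated:
  assumes "S \<subseteq> carrier M"
  shows "submodule (submodule_generated R M S) R M"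
proof (rule submoduleI)
  \<comment> \<open>The intersection runs over a nonempty family, because \<open>carrier M\<close>
    is itself a submodule containing \<open>S\<close>; an empty intersection would be the whole
    type.\<close>
  have "submodule (carrier M) R M"
    by (rule submoduleI) auto
  with assms show "submodule_generated R M S \<subseteq> carrier M"
    unfolding submodule_generated_def by blast
  show "\<zero>\<^bsub>M\<^esub> \<in> submodule_generated R M S"
    unfolding submodule_generated_def using subgroup.one_closed[OF submodule.axioms(1)] by fastforce
next
  fix x assume "x \<in> submodule_generated R M S"
  then show "\<ominus>\<^bsub>M\<^esub> x \<in> submodule_generated R M S"
    unfolding submodule_generated_def using submoduleE(3) by blast
next
  fix x y assume "x \<in> submodule_generated R M S" "y \<in> submodule_generated R M S"
  then show "x \<oplus>\<^bsub>M\<^esub> y \<in> submodule_generated R M S"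
    unfolding submodule_generated_def using submoduleE(5) by blast
next
  fix r x assume "r \<in> carrier R" "x \<in> submodule_generated R M S"
  then show "r \<odot>\<^bsub>M\<^esub> x \<in> submodule_generated R M S"
    unfolding submodule_generated_def using submoduleE(4) by blast
qed

lemma submodule_generated_least:
  assumes "submodule N R M" and "S \<subseteq> N"
  shows "submodule_generated R M S \<subseteq> N"
  using assms unfolding submodule_generated_def by blast

section \<open>Linear functionals and their kernels\<close>

lemma functional_closed:
  "\<lbrakk>\<phi> \<in> mod_hom R M (regular_module R); x \<in> carrier M\<rbrakk> \<Longrightarrow> \<phi> x \<in> carrier R"
  by (auto simp: mod_hom_def regular_module_def)

lemma functional_add:
  "\<lbrakk>\<phi> \<in> mod_hom R M (regular_module R); x \<in> carrier M; y \<in> carrier M\<rbrakk>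
    \<Longrightarrow> \<phi> (x \<oplus>\<^bsub>M\<^esub> y) = \<phi> x \<oplus> \<phi> y"
  by (auto simp: mod_hom_def regular_module_def)

lemma functional_smult:
  "\<lbrakk>\<phi> \<in> mod_hom R M (regular_module R); r \<in> carrier R; x \<in> carrier M\<rbrakk>
    \<Longrightarrow> \<phi> (r \<odot>\<^bsub>M\<^esub> x) = r \<otimes> \<phi> x"
  by (auto simp: mod_hom_def regular_module_def)

lemma functional_zero:
  assumes "\<phi> \<in> mod_hom R M (regular_module R)"
  shows "\<phi> \<zero>\<^bsub>M\<^esub> = \<zero>"
  using functional_smult[OF assms R.zero_closed M.zero_closed] functional_closed[OF assms M.zero_closed]
  by simp

lemma functional_neg:
  assumes \<phi>: "\<phi> \<in> mod_hom R M (regular_module R)" and x: "x \<in> carrier M"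
  shows "\<phi> (\<ominus>\<^bsub>M\<^esub> x) = \<ominus> \<phi> x"
proof -
  have "\<phi> (\<ominus>\<^bsub>M\<^esub> x) \<oplus> \<phi> x = \<zero>"
    using functional_add[OF \<phi> M.a_inv_closed[OF x] x] x
    by (simp add: M.l_neg functional_zero[OF \<phi>])
  then show ?thesis
    using functional_closed[OF \<phi>] x by (simp add: R.minus_equality)
qed

text \<open>Together with \<open>submodule_generated_least\<close>, this reduces vanishing on a
  generated submodule to vanishing on the generators.\<close>

lemma submodule_functional_kernel:
  assumes "\<phi> \<in> mod_hom R M (regular_module R)"
  shows "submodule {x \<in> carrier M. \<phi> x = \<zero>} R M"
  by (rule submoduleI)
    (auto simp: functional_zero[OF assms] functional_neg[OF assms] functional_add[OF assms]
      functional_smult[OF assms])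

section \<open>Additive group of a quotient module\<close>

lemma abelian_subgroup_submodule:
  assumes "submodule N R M"
  shows "abelian_subgroup N M"
  using submodule.axioms(1)[OF assms]
  by (intro abelian_subgroupI3) (auto intro: additive_subgroup.intro M.abelian_group_axioms)

lemma abelian_group_quotient_module:
  assumes "submodule N R M"
  shows "abelian_group (quotient_module M N)"
proof -
  \<comment> \<open>\<open>?Q\<close> is the factor group \<open>A_FactGroup\<close> written out.
    Its carrier, product and unit are the carrier, sum and zero of \<open>quotient_module\<close>,
    so its group laws carry over one by one.\<close>
  let ?Q = "\<lparr>carrier = a_rcosets\<^bsub>M\<^esub> N, mult = (<+>\<^bsub>M\<^esub>), one = N\<rparr>"
  interpret Q: comm_group ?Q
    using abelian_subgroup.a_factorgroup_is_comm_group[OF abelian_subgroup_submodule[OF assms]]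
    by (simp only: A_FactGroup_def')
  show ?thesis
    unfolding quotient_module_def
    by (rule abelian_groupI)
      (use Q.m_closed Q.one_closed Q.m_assoc Q.m_comm Q.l_one Q.l_inv_ex in \<open>simp_all\<close>)
qed

end


section \<open>Linear extension to free modules\<close>

text \<open>The functional on the free module with value \<open>h q\<close> at the generator of
  \<open>q\<close>. Summing over the support keeps the index set finite for elements of
  \<open>free_module\<close>; over an infinite set \<open>finsum\<close> returns zero by
  default.\<close>

definition lin_ext :: "('r, 'x) ring_scheme \<Rightarrow> 'i set \<Rightarrow> ('i \<Rightarrow> 'r) \<Rightarrow> ('i \<Rightarrow> 'r) \<Rightarrow> 'r"
  where "lin_ext R X h f = (\<Oplus>\<^bsub>R\<^esub>p\<in>{p \<in> X. f p \<noteq> \<zero>\<^bsub>R\<^esub>}. f p \<otimes>\<^bsub>R\<^esub> h p)"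

context cring
begin

lemma free_module_carrierD:
  assumes "f \<in> carrier (free_module R X)"
  shows "f \<in> X \<rightarrow> carrier R" "finite {p \<in> X. f p \<noteq> \<zero>}"
  using assms by (auto simp: free_module_def)

text \<open>The laws hold pointwise. What needs an argument is finite support: sums, negatives and
  scalar multiples are supported in the union of the supports of their arguments.\<close>

lemma module_free_module: "module R (free_module R X)"
proof (rule moduleI)
  show "cring R" ..
  have add: "(\<lambda>p\<in>X. f p \<oplus> g p) \<in> carrier (free_module R X)"
    if "f \<in> carrier (free_module R X)" "g \<in> carrier (free_module R X)" for f g
  proof -
    have "{p \<in> X. f p \<oplus> g p \<noteq> \<zero>} \<subseteq> {p \<in> X. f p \<noteq> \<zero>} \<union> {p \<in> X. g p \<noteq> \<zero>}"
      by auto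
    then have "finite {p \<in> X. f p \<oplus> g p \<noteq> \<zero>}"
      by (rule finite_subset) (use that in \<open>simp add: free_module_carrierD(2)\<close>)
    \<comment> \<open>The congruence rule makes \<open>p \<in> X\<close> available while the second
      conjunct of the support is simplified, so that the restriction to \<open>X\<close> unfolds
      there.\<close>
    with that show ?thesis
      by (auto simp: free_module_def cong: conj_cong)
  qed
  have neg: "(\<lambda>p\<in>X. \<ominus> f p) \<in> carrier (free_module R X)"
    if "f \<in> carrier (free_module R X)" for f
  proof -
    have "{p \<in> X. \<ominus> f p \<noteq> \<zero>} \<subseteq> {p \<in> X. f p \<noteq> \<zero>}"
      by auto
    then have "finite {p \<in> X. \<ominus> f p \<noteq> \<zero>}"
      by (rule finite_subset) (use that in \<open>simp add: free_module_carrierD(2)\<close>)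
    with that show ?thesis
      by (auto simp: free_module_def cong: conj_cong)
  qed
  show "abelian_group (free_module R X)"
  proof (rule abelian_groupI)
    fix f assume f: "f \<in> carrier (free_module R X)"
    show "\<exists>g\<in>carrier (free_module R X). g \<oplus>\<^bsub>free_module R X\<^esub> f = \<zero>\<^bsub>free_module R X\<^esub>"
      \<comment> \<open>The witness is the pointwise negative supplied by
        \<open>neg\<close>.\<close>
      using f by (intro bexI[OF _ neg[OF f]]) (auto simp: free_module_def fun_eq_iff PiE_iff l_neg)
    show "\<zero>\<^bsub>free_module R X\<^esub> \<oplus>\<^bsub>free_module R X\<^esub> f = f"
      using f by (auto simp: free_module_def fun_eq_iff PiE_iff extensional_def)
  qed (use add in \<open>auto simp: free_module_def fun_eq_iff PiE_iff a_ac\<close>)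
  show "r \<odot>\<^bsub>free_module R X\<^esub> f \<in> carrier (free_module R X)"
    if "r \<in> carrier R" "f \<in> carrier (free_module R X)" for r f
  proof -
    have "{p \<in> X. r \<otimes> f p \<noteq> \<zero>} \<subseteq> {p \<in> X. f p \<noteq> \<zero>}"
      using that by auto
    then have "finite {p \<in> X. r \<otimes> f p \<noteq> \<zero>}"
      by (rule finite_subset) (use that in \<open>simp add: free_module_carrierD(2)\<close>)
    with that show ?thesis
      by (auto simp: free_module_def cong: conj_cong)
  qed
qed (auto simp: free_module_def fun_eq_iff PiE_iff extensional_def l_distr r_distr m_assoc)

lemma free_gen_closed: "free_gen R X q \<in> carrier (free_module R X)"
proof -
  have "{p \<in> X. free_gen R X q p \<noteq> \<zero>} \<subseteq> {q}"
    by (auto simp: free_gen_def)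
  then have "finite {p \<in> X. free_gen R X q p \<noteq> \<zero>}"
    by (rule finite_subset) simp
  then show ?thesis
    by (auto simp: free_module_def free_gen_def)
qed

lemma lin_ext_closed:
  assumes "h \<in> X \<rightarrow> carrier R" and "f \<in> carrier (free_module R X)"
  shows "lin_ext R X h f \<in> carrier R"
  using assms(1) free_module_carrierD[OF assms(2)] unfolding lin_ext_def
  by (intro finsum_closed) auto

text \<open>The terms added outside the support have coefficient zero. Elements with different
  supports can thus be summed over one common index set.\<close>

lemma lin_ext_eq_finsum:
  assumes "h \<in> X \<rightarrow> carrier R" and "f \<in> X \<rightarrow> carrier R"
    and "finite S" and "S \<subseteq> X" and "{p \<in> X. f p \<noteq> \<zero>} \<subseteq> S"
  shows "lin_ext R X h f = (\<Oplus>p\<in>S. f p \<otimes> h p)"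
  unfolding lin_ext_def using assms
  by (intro add.finprod_mono_neutral_cong_left) (auto simp: subset_iff Pi_iff)

lemma lin_ext_free_gen:
  assumes "h \<in> X \<rightarrow> carrier R" and "q \<in> X"
  shows "lin_ext R X h (free_gen R X q) = h q"
proof -
  \<comment> \<open>The support is contained in \<open>{q}\<close>, and is empty in the zero ring;
    passing to the superset \<open>{q}\<close> treats both cases at once.\<close>
  have "lin_ext R X h (free_gen R X q) = (\<Oplus>p\<in>{q}. free_gen R X q p \<otimes> h p)"
    using assms by (intro lin_ext_eq_finsum) (auto simp: free_gen_def)
  also have "\<dots> = h q"
    using assms by (simp add: free_gen_def Pi_iff)
  finally show ?thesis .
qed

lemma lin_ext_mod_hom:
  assumes h: "h \<in> X \<rightarrow> carrier R"
  shows "lin_ext R X h \<in> mod_hom R (free_module R X) (regular_module R)"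
proof -
  interpret F: module R "free_module R X" by (rule module_free_module)
  have "lin_ext R X h (f \<oplus>\<^bsub>free_module R X\<^esub> g) = lin_ext R X h f \<oplus> lin_ext R X h g"
    if f: "f \<in> carrier (free_module R X)" and g: "g \<in> carrier (free_module R X)" for f g
  proof -
    \<comment> \<open>\<open>f\<close>, \<open>g\<close> and their sum may have three different
      supports; the union of the first two contains all of them.\<close>
    define S where "S = {p \<in> X. f p \<noteq> \<zero>} \<union> {p \<in> X. g p \<noteq> \<zero>}"
    have S: "finite S" "S \<subseteq> X" "{p \<in> X. f p \<noteq> \<zero>} \<subseteq> S" "{p \<in> X. g p \<noteq> \<zero>} \<subseteq> S"
      using free_module_carrierD[OF f] free_module_carrierD[OF g] by (auto simp: S_def)
    have closed: "h p \<in> carrier R" "f p \<in> carrier R" "g p \<in> carrier R"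
      and add: "(f \<oplus>\<^bsub>free_module R X\<^esub> g) p = f p \<oplus> g p" if "p \<in> S" for p
      using that S(2) h free_module_carrierD(1)[OF f] free_module_carrierD(1)[OF g]
      by (auto simp: free_module_def)
    have "lin_ext R X h (f \<oplus>\<^bsub>free_module R X\<^esub> g)
        = (\<Oplus>p\<in>S. (f \<oplus>\<^bsub>free_module R X\<^esub> g) p \<otimes> h p)"
      using free_module_carrierD(1)[OF F.M.a_closed[OF f g]]
      by (intro lin_ext_eq_finsum h S) (auto simp: S_def free_module_def)
    also have "\<dots> = (\<Oplus>p\<in>S. f p \<otimes> h p \<oplus> g p \<otimes> h p)"
      by (intro finsum_cong') (simp_all add: closed add l_distr)
    also have "\<dots> = (\<Oplus>p\<in>S. f p \<otimes> h p) \<oplus> (\<Oplus>p\<in>S. g p \<otimes> h p)"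
      by (intro finsum_addf) (simp_all add: closed)
    also have "\<dots> = lin_ext R X h f \<oplus> lin_ext R X h g"
      using S lin_ext_eq_finsum[OF h free_module_carrierD(1)[OF f]]
        lin_ext_eq_finsum[OF h free_module_carrierD(1)[OF g]] by simp
    finally show ?thesis .
  qed
  moreover have "lin_ext R X h (r \<odot>\<^bsub>free_module R X\<^esub> f) = r \<otimes> lin_ext R X h f"
    if r: "r \<in> carrier R" and f: "f \<in> carrier (free_module R X)" for r f
  proof -
    \<comment> \<open>Zero divisors may shrink the support of the multiple, so all sums are taken
      over the support of \<open>f\<close>.\<close>
    define S where "S = {p \<in> X. f p \<noteq> \<zero>}"
    have S: "finite S" "S \<subseteq> X"
      using free_module_carrierD[OF f] by (auto simp: S_def)
    have closed: "h p \<in> carrier R" "f p \<in> carrier R"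
      and smult: "(r \<odot>\<^bsub>free_module R X\<^esub> f) p = r \<otimes> f p" if "p \<in> S" for p
      using that S(2) h free_module_carrierD(1)[OF f] by (auto simp: free_module_def)
    have "lin_ext R X h (r \<odot>\<^bsub>free_module R X\<^esub> f) = (\<Oplus>p\<in>S. (r \<odot>\<^bsub>free_module R X\<^esub> f) p \<otimes> h p)"
      using free_module_carrierD(1)[OF F.smult_closed[OF r f]] r
      by (intro lin_ext_eq_finsum h S) (auto simp: S_def free_module_def)
    also have "\<dots> = (\<Oplus>p\<in>S. r \<otimes> (f p \<otimes> h p))"
      using r by (intro finsum_cong') (simp_all add: closed smult m_assoc)
    also have "\<dots> = r \<otimes> lin_ext R X h f"
      unfolding lin_ext_def S_def[symmetric]
      using S(1) r by (intro finsum_rdistr[symmetric]) (simp_all add: closed)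
    finally show ?thesis .
  qed
  ultimately show ?thesis
    using lin_ext_closed[OF h] by (simp add: mod_hom_def regular_module_def)
qed

text \<open>Linearity in the weight \<open>h\<close> rather than in \<open>f\<close>: the index set
  depends on \<open>f\<close> only, so the sums are added term by term. It serves for nested
  extensions, where the weight is itself a \<open>lin_ext\<close>.\<close>

lemma lin_ext_add_left:
  assumes h: "h \<in> X \<rightarrow> carrier R" and h': "h' \<in> X \<rightarrow> carrier R"
    and f: "f \<in> carrier (free_module R X)"
  shows "lin_ext R X (\<lambda>p. h p \<oplus> h' p) f = lin_ext R X h f \<oplus> lin_ext R X h' f"
proof -
  note fX = free_module_carrierD[OF f]
  have "lin_ext R X (\<lambda>p. h p \<oplus> h' p) f
      = (\<Oplus>p\<in>{p \<in> X. f p \<noteq> \<zero>}. f p \<otimes> h p \<oplus> f p \<otimes> h' p)"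
    unfolding lin_ext_def using h h' fX by (intro finsum_cong') (auto simp: Pi_iff r_distr)
  also have "\<dots> = lin_ext R X h f \<oplus> lin_ext R X h' f"
    unfolding lin_ext_def using h h' fX by (intro finsum_addf) auto
  finally show ?thesis .
qed

lemma lin_ext_smult_left:
  assumes h: "h \<in> X \<rightarrow> carrier R" and r: "r \<in> carrier R"
    and f: "f \<in> carrier (free_module R X)"
  shows "lin_ext R X (\<lambda>p. r \<otimes> h p) f = r \<otimes> lin_ext R X h f"
proof -
  note fX = free_module_carrierD[OF f]
  have "lin_ext R X (\<lambda>p. r \<otimes> h p) f = (\<Oplus>p\<in>{p \<in> X. f p \<noteq> \<zero>}. r \<otimes> (f p \<otimes> h p))"
    unfolding lin_ext_def using h r fX by (intro finsum_cong') (auto simp: Pi_iff m_lcomm)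
  also have "\<dots> = r \<otimes> lin_ext R X h f"
    unfolding lin_ext_def using h r fX by (intro finsum_rdistr[symmetric]) auto
  finally show ?thesis .
qed

lemma lin_ext_zero_left:
  assumes "f \<in> carrier (free_module R X)" and "\<And>p. p \<in> X \<Longrightarrow> h p = \<zero>"
  shows "lin_ext R X h f = \<zero>"
proof -
  have "lin_ext R X h f = (\<Oplus>p\<in>{p \<in> X. f p \<noteq> \<zero>}. \<zero>)"
    unfolding lin_ext_def using assms free_module_carrierD[OF assms(1)]
    by (intro finsum_cong') (auto simp: Pi_iff)
  then show ?thesis by simp
qed

lemma lin_ext_cong:
  assumes "\<And>p. p \<in> X \<Longrightarrow> h p = h' p" and "h' \<in> X \<rightarrow> carrier R"
    and "f \<in> carrier (free_module R X)"
  shows "lin_ext R X h f = lin_ext R X h' f"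
  unfolding lin_ext_def using assms free_module_carrierD[OF assms(3)]
  by (intro finsum_cong') auto

end


section \<open>Multilinear functions and the tensor power\<close>

text \<open>Linearity in one slot is expressed through the updates \<open>p(i := v)\<close>, the
  same form that the generators in \<open>multilinear_relations\<close> have.\<close>

definition multilinear ::
    "('r, 'x) ring_scheme \<Rightarrow> ('r, 'v, 'y) module_scheme \<Rightarrow> nat \<Rightarrow> ((nat \<Rightarrow> 'v) \<Rightarrow> 'r) \<Rightarrow> bool"
  where "multilinear R V n h \<longleftrightarrow> h \<in> tuples V n \<rightarrow> carrier R \<and>
    (\<forall>p\<in>tuples V n. \<forall>i<n. (\<lambda>v. h (p(i := v))) \<in> mod_hom R V (regular_module R))"

lemma tuples_update: "\<lbrakk>p \<in> tuples V n; i < n; v \<in> carrier V\<rbrakk> \<Longrightarrow> p(i := v) \<in> tuples V n"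
  by (auto simp: tuples_def PiE_iff extensional_def)

context module
begin

lemma multilinear_relations_closed:
  "multilinear_relations R M n \<subseteq> carrier (free_module R (tuples M n))"
proof -
  interpret F: module R "free_module R (tuples M n)" by (rule module_free_module)
  show ?thesis
    unfolding multilinear_relations_def Let_def by (auto intro!: F.M.minus_closed free_gen_closed)
qed

lemma submodule_tensor_kernel: "submodule (tensor_kernel R M n) R (free_module R (tuples M n))"
  unfolding tensor_kernel_def
  by (rule module.submodule_submodule_generated[OF module_free_module multilinear_relations_closed])

lemma tensor_kernel_closed: "tensor_kernel R M n \<subseteq> carrier (free_module R (tuples M n))"
  by (rule module.submoduleE(1)[OF module_free_module submodule_tensor_kernel])

text \<open>This is the factorization in the universal property of the tensor power: the linear
  extension of a multilinear function is well defined on cosets of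
  \<open>tensor_kernel\<close>.\<close>

lemma lin_ext_multilinear_tensor_kernel:
  assumes h: "multilinear R M n h" and f: "f \<in> tensor_kernel R M n"
  shows "lin_ext R (tuples M n) h f = \<zero>"
proof -
  let ?X = "tuples M n"
  let ?F = "free_module R ?X"
  let ?L = "lin_ext R ?X h"
  interpret F: module R ?F by (rule module_free_module)
  have hX: "h \<in> ?X \<rightarrow> carrier R"
    and lin: "\<And>p i. \<lbrakk>p \<in> ?X; i < n\<rbrakk> \<Longrightarrow> (\<lambda>v. h (p(i := v))) \<in> mod_hom R M (regular_module R)"
    using h by (auto simp: multilinear_def)
  note L = lin_ext_mod_hom[OF hX]
  \<comment> \<open>Both kinds of relations are differences, so it is enough that the extension
    agrees on the two terms; this is exactly linearity of \<open>h\<close> in slot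
    \<open>i\<close>.\<close>
  have minus: "?L (x \<ominus>\<^bsub>?F\<^esub> y) = \<zero>" if "x \<in> carrier ?F" "y \<in> carrier ?F" "?L x = ?L y" for x y
    using that F.functional_closed[OF L]
    by (simp add: a_minus_def F.functional_add[OF L] F.functional_neg[OF L] R.r_neg)
  let ?\<delta> = "free_gen R ?X"
  have add: "?L (?\<delta> (p(i := v \<oplus>\<^bsub>M\<^esub> w)) \<ominus>\<^bsub>?F\<^esub> (?\<delta> (p(i := v)) \<oplus>\<^bsub>?F\<^esub> ?\<delta> (p(i := w)))) = \<zero>"
    if "p \<in> ?X" "i < n" "v \<in> carrier M" "w \<in> carrier M" for p i v w
    by (rule minus)
      (simp_all only: that tuples_update M.a_closed F.M.a_closed free_gen_closed
        F.functional_add[OF L] lin_ext_free_gen[OF hX] functional_add[OF lin[OF that(1,2)]])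
  have smult: "?L (?\<delta> (p(i := r \<odot>\<^bsub>M\<^esub> v)) \<ominus>\<^bsub>?F\<^esub> r \<odot>\<^bsub>?F\<^esub> ?\<delta> (p(i := v))) = \<zero>"
    if "p \<in> ?X" "i < n" "r \<in> carrier R" "v \<in> carrier M" for p i r v
    by (rule minus)
      (simp_all only: that tuples_update smult_closed F.smult_closed free_gen_closed
        F.functional_smult[OF L] lin_ext_free_gen[OF hX] functional_smult[OF lin[OF that(1,2)]])
  have "?L g = \<zero>" if "g \<in> multilinear_relations R M n" for g
    using that unfolding multilinear_relations_def Let_def
    by (elim UnE CollectE exE conjE) (simp_all only: add smult)
  then have "multilinear_relations R M n \<subseteq> {x \<in> carrier ?F. ?L x = \<zero>}"
    using multilinear_relations_closed by blast
  then have "tensor_kernel R M n \<subseteq> {x \<in> carrier ?F. ?L x = \<zero>}"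
    unfolding tensor_kernel_def
    by (rule F.submodule_generated_least[OF F.submodule_functional_kernel[OF L]])
  with f show ?thesis by blast
qed

text \<open>Only the factor with index \<open>i\<close> depends on \<open>v\<close>; the others form
  a constant \<open>a\<close>, and a functional times a constant is a functional. The family
  \<open>c\<close> leaves open which argument of the form is held fixed.\<close>

lemma finprod_update_functional:
  assumes c: "c \<in> {..<n} \<rightarrow> carrier M \<rightarrow> carrier R" and p: "p \<in> tuples M n" and i: "i < n"
    and ci: "c i \<in> mod_hom R M (regular_module R)"
  shows "(\<lambda>v. \<Otimes>j\<in>{..<n}. c j ((p(i := v)) j)) \<in> mod_hom R M (regular_module R)"
proof -
  define a where "a = (\<Otimes>j\<in>{..<n} - {i}. c j (p j))"
  have closed: "c j (p j) \<in> carrier R" if "j < n" for j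
    using c p that by (auto simp: tuples_def PiE_iff Pi_iff)
  have a: "a \<in> carrier R"
    unfolding a_def by (rule finprod_closed) (auto simp: closed)
  have "(\<Otimes>j\<in>{..<n}. c j ((p(i := v)) j)) = c i v \<otimes> a" if v: "v \<in> carrier M" for v
  proof -
    have "(\<Otimes>j\<in>insert i ({..<n} - {i}). c j ((p(i := v)) j))
        = c i v \<otimes> (\<Otimes>j\<in>{..<n} - {i}. c j ((p(i := v)) j))"
      using closed functional_closed[OF ci v] by (subst finprod_insert) auto
    also have "(\<Otimes>j\<in>{..<n} - {i}. c j ((p(i := v)) j)) = a"
      unfolding a_def using closed by (intro finprod_cong') auto
    also have "insert i ({..<n} - {i}) = {..<n}"
      using i by auto
    finally show ?thesis .
  qed
  then show ?thesis
    using a ci by (simp add: mod_hom_def regular_module_def Pi_iff l_distr m_assoc)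
qed

lemma tensor_power_cases:
  assumes "A \<in> carrier (tensor_power R M n)"
  obtains f where "f \<in> carrier (free_module R (tuples M n))"
    and "A = tensor_kernel R M n +>\<^bsub>free_module R (tuples M n)\<^esub> f"
  using assms by (auto simp: tensor_power_def quotient_module_def A_RCOSETS_def')

lemma abelian_group_tensor_power: "abelian_group (tensor_power R M n)"
  unfolding tensor_power_def
  by (rule module.abelian_group_quotient_module[OF module_free_module submodule_tensor_kernel])

end

section \<open>Bilinear form on the free module\<close>

locale bilinear_module = module R V
  for R :: "('r, 'x) ring_scheme" (structure)
    and V :: "('r, 'v, 'y) module_scheme" (structure)
    and \<beta> :: "'v \<Rightarrow> 'v \<Rightarrow> 'r" +
  assumes bilinear: "bilinear_form R V \<beta>"

context bilinear_module
begin

lemma form_closed: "\<lbrakk>v \<in> carrier V; w \<in> carrier V\<rbrakk> \<Longrightarrow> \<beta> v w \<in> carrier R"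
  using bilinear functional_closed[of "\<beta> v" w] by (simp add: bilinear_form_def)

lemma prod_form_closed:
  "\<lbrakk>p \<in> tuples V n; q \<in> tuples V n\<rbrakk> \<Longrightarrow> (\<Otimes>i\<in>{..<n}. \<beta> (p i) (q i)) \<in> carrier R"
  by (rule finprod_closed) (auto simp: tuples_def PiE_iff intro!: form_closed)

lemma multilinear_prod_form_right:
  assumes p: "p \<in> tuples V n"
  shows "multilinear R V n (\<lambda>q. \<Otimes>i\<in>{..<n}. \<beta> (p i) (q i))"
proof -
  have "p i \<in> carrier V" if "i < n" for i
    using p that by (auto simp: tuples_def PiE_iff)
  then show ?thesis
    unfolding multilinear_def using bilinear
    by (intro conjI ballI allI impI finprod_update_functional)
      (auto simp: bilinear_form_def prod_form_closed[OF p] form_closed)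
qed

lemma multilinear_prod_form_left:
  assumes q: "q \<in> tuples V n"
  shows "multilinear R V n (\<lambda>p. \<Otimes>i\<in>{..<n}. \<beta> (p i) (q i))"
proof -
  have "q i \<in> carrier V" if "i < n" for i
    using q that by (auto simp: tuples_def PiE_iff)
  then show ?thesis
    unfolding multilinear_def using bilinear
    by (intro conjI ballI allI impI finprod_update_functional[where c = "\<lambda>i v. \<beta> v (q i)"])
      (auto simp: bilinear_form_def prod_form_closed[OF _ q] form_closed)
qed

text \<open>For each \<open>q\<close> the weight is multilinear in \<open>p\<close>, and
  \<open>lin_ext\<close> is linear in its weight, so multilinearity survives the summation over
  \<open>q\<close>.\<close>

lemma multilinear_lin_ext:
  assumes g: "g \<in> carrier (free_module R (tuples V n))"
  shows "multilinear R V n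
    (\<lambda>p. lin_ext R (tuples V n) (\<lambda>q. \<Otimes>i\<in>{..<n}. \<beta> (p i) (q i)) g)"
proof -
  let ?X = "tuples V n"
  let ?P = "\<lambda>p q. \<Otimes>i\<in>{..<n}. \<beta> (p i) (q i)"
  have P: "?P p \<in> ?X \<rightarrow> carrier R" if "p \<in> ?X" for p
    using prod_form_closed[OF that] by auto
  have lin: "(\<lambda>v. ?P (p(i := v)) q) \<in> mod_hom R V (regular_module R)"
    if "p \<in> ?X" "i < n" "q \<in> ?X" for p i q
    using multilinear_prod_form_left[OF that(3)] that(1,2) by (simp add: multilinear_def)
  have add: "lin_ext R ?X (?P (p(i := v \<oplus>\<^bsub>V\<^esub> w))) g
      = lin_ext R ?X (?P (p(i := v))) g \<oplus> lin_ext R ?X (?P (p(i := w))) g"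
    if p: "p \<in> ?X" "i < n" and v: "v \<in> carrier V" and w: "w \<in> carrier V" for p i v w
  proof -
    note Pv = P[OF tuples_update[OF p v]] and Pw = P[OF tuples_update[OF p w]]
    have "lin_ext R ?X (?P (p(i := v \<oplus>\<^bsub>V\<^esub> w))) g
        = lin_ext R ?X (\<lambda>q. ?P (p(i := v)) q \<oplus> ?P (p(i := w)) q) g"
      using Pv Pw by (intro lin_ext_cong g functional_add[OF lin[OF p]] v w) auto
    then show ?thesis
      using lin_ext_add_left[OF Pv Pw g] by simp
  qed
  have smult: "lin_ext R ?X (?P (p(i := r \<odot>\<^bsub>V\<^esub> v))) g = r \<otimes> lin_ext R ?X (?P (p(i := v))) g"
    if p: "p \<in> ?X" "i < n" and r: "r \<in> carrier R" and v: "v \<in> carrier V" for p i r v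
  proof -
    note Pv = P[OF tuples_update[OF p v]]
    have "lin_ext R ?X (?P (p(i := r \<odot>\<^bsub>V\<^esub> v))) g = lin_ext R ?X (\<lambda>q. r \<otimes> ?P (p(i := v)) q) g"
      using Pv r by (intro lin_ext_cong g functional_smult[OF lin[OF p]] v) auto
    then show ?thesis
      using lin_ext_smult_left[OF Pv r g] by simp
  qed
  show ?thesis
    unfolding multilinear_def mod_hom_def regular_module_def
    \<comment> \<open>Without \<open>fun_upd_apply\<close> the updated tuples keep the shape in
      which \<open>add\<close> and \<open>smult\<close> state them, instead of becoming case
      distinctions inside the products.\<close>
    using lin_ext_closed[OF P g] lin_ext_closed[OF P[OF tuples_update] g] add smult
    by (simp add: Pi_iff del: fun_upd_apply)
qed

text \<open>The factor \<open>f p\<close> is independent of \<open>q\<close> and leaves the inner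
  sum. The double sum becomes an iterated extension, to which the facts on \<open>lin_ext\<close>
  apply.\<close>

lemma free_form_eq_lin_ext:
  assumes f: "f \<in> carrier (free_module R (tuples V n))"
    and g: "g \<in> carrier (free_module R (tuples V n))"
  shows "free_form R V \<beta> n f g = lin_ext R (tuples V n)
    (\<lambda>p. lin_ext R (tuples V n) (\<lambda>q. \<Otimes>i\<in>{..<n}. \<beta> (p i) (q i)) g) f"
proof -
  let ?X = "tuples V n"
  let ?P = "\<lambda>p q. \<Otimes>i\<in>{..<n}. \<beta> (p i) (q i)"
  note fX = free_module_carrierD[OF f] and gX = free_module_carrierD[OF g]
  have "(\<Oplus>q\<in>{q \<in> ?X. g q \<noteq> \<zero>}. f p \<otimes> g q \<otimes> ?P p q) = f p \<otimes> lin_ext R ?X (?P p) g"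
    if p: "p \<in> ?X" for p
  proof -
    have fp: "f p \<in> carrier R" using fX p by auto
    have "(\<Oplus>q\<in>{q \<in> ?X. g q \<noteq> \<zero>}. f p \<otimes> g q \<otimes> ?P p q)
        = (\<Oplus>q\<in>{q \<in> ?X. g q \<noteq> \<zero>}. f p \<otimes> (g q \<otimes> ?P p q))"
      using fp gX prod_form_closed[OF p] by (intro R.finsum_cong') (auto simp: Pi_iff m_assoc)
    also have "\<dots> = f p \<otimes> lin_ext R ?X (?P p) g"
      unfolding lin_ext_def using fp gX prod_form_closed[OF p]
      by (intro finsum_rdistr[symmetric]) auto
    finally show ?thesis .
  qed
  moreover have "lin_ext R ?X (?P p) g \<in> carrier R" if "p \<in> ?X" for p
    using prod_form_closed[OF that] by (intro lin_ext_closed g) auto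
  ultimately show ?thesis
    unfolding free_form_def lin_ext_def[of R ?X _ f] using fX by (intro R.finsum_cong') auto
qed

lemma free_form_functional_left:
  assumes g: "g \<in> carrier (free_module R (tuples V n))"
  shows "(\<lambda>f. free_form R V \<beta> n f g) \<in> mod_hom R (free_module R (tuples V n)) (regular_module R)"
proof -
  interpret F: module R "free_module R (tuples V n)" by (rule module_free_module)
  have "(\<lambda>p. lin_ext R (tuples V n) (\<lambda>q. \<Otimes>i\<in>{..<n}. \<beta> (p i) (q i)) g) \<in> tuples V n \<rightarrow> carrier R"
    using multilinear_lin_ext[OF g] by (simp add: multilinear_def)
  from lin_ext_mod_hom[OF this] show ?thesis
    by (simp add: mod_hom_def free_form_eq_lin_ext g Pi_iff)
qed

text \<open>Here \<open>g\<close> varies inside the weight of the outer extension. The inner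
  extension is linear in \<open>g\<close> for each \<open>p\<close>, and the outer one is linear in
  its weight.\<close>

lemma free_form_functional_right:
  assumes f: "f \<in> carrier (free_module R (tuples V n))"
  shows "free_form R V \<beta> n f \<in> mod_hom R (free_module R (tuples V n)) (regular_module R)"
proof -
  let ?X = "tuples V n"
  let ?L = "\<lambda>g p. lin_ext R ?X (\<lambda>q. \<Otimes>i\<in>{..<n}. \<beta> (p i) (q i)) g"
  interpret F: module R "free_module R ?X" by (rule module_free_module)
  have closed: "?L g \<in> ?X \<rightarrow> carrier R" if "g \<in> carrier (free_module R ?X)" for g
    using multilinear_lin_ext[OF that] by (simp add: multilinear_def)
  have hom: "(\<lambda>g. ?L g p) \<in> mod_hom R (free_module R ?X) (regular_module R)" if "p \<in> ?X" for p
    using prod_form_closed[OF that] by (intro lin_ext_mod_hom) auto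
  have "free_form R V \<beta> n f (g \<oplus>\<^bsub>free_module R ?X\<^esub> g') = free_form R V \<beta> n f g \<oplus> free_form R V \<beta> n f g'"
    if g: "g \<in> carrier (free_module R ?X)" and g': "g' \<in> carrier (free_module R ?X)" for g g'
  proof -
    have "lin_ext R ?X (?L (g \<oplus>\<^bsub>free_module R ?X\<^esub> g')) f = lin_ext R ?X (\<lambda>p. ?L g p \<oplus> ?L g' p) f"
      using closed[OF g] closed[OF g']
      by (intro lin_ext_cong f F.functional_add[OF hom] g g') auto
    then show ?thesis
      using lin_ext_add_left[OF closed[OF g] closed[OF g'] f]
      by (simp add: free_form_eq_lin_ext f g g')
  qed
  moreover have "free_form R V \<beta> n f (r \<odot>\<^bsub>free_module R ?X\<^esub> g) = r \<otimes> free_form R V \<beta> n f g"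
    if r: "r \<in> carrier R" and g: "g \<in> carrier (free_module R ?X)" for r g
  proof -
    have "lin_ext R ?X (?L (r \<odot>\<^bsub>free_module R ?X\<^esub> g)) f = lin_ext R ?X (\<lambda>p. r \<otimes> ?L g p) f"
      using closed[OF g] r
      by (intro lin_ext_cong f F.functional_smult[OF hom] g) auto
    then show ?thesis
      using lin_ext_smult_left[OF closed[OF g] r f] r g
      by (simp add: free_form_eq_lin_ext f)
  qed
  ultimately show ?thesis
    using lin_ext_closed[OF closed f] f
    by (simp add: mod_hom_def regular_module_def free_form_eq_lin_ext)
qed

section \<open>Descent of the form to the tensor power\<close>

lemma free_form_tensor_kernel_left:
  assumes "f \<in> tensor_kernel R V n" and "g \<in> carrier (free_module R (tuples V n))"
  shows "free_form R V \<beta> n f g = \<zero>"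
  using assms tensor_kernel_closed lin_ext_multilinear_tensor_kernel[OF multilinear_lin_ext]
  by (subst free_form_eq_lin_ext) auto

text \<open>The inner extension already vanishes for every \<open>p\<close>, so the outer one has
  weight zero. In the left argument it is the outer extension, with its multilinear weight, that
  vanishes.\<close>

lemma free_form_tensor_kernel_right:
  assumes "f \<in> carrier (free_module R (tuples V n))" and "g \<in> tensor_kernel R V n"
  shows "free_form R V \<beta> n f g = \<zero>"
  using assms tensor_kernel_closed
    lin_ext_multilinear_tensor_kernel[OF multilinear_prod_form_right]
  by (subst free_form_eq_lin_ext) (auto intro: lin_ext_zero_left)

lemma tensor_form_cosets:
  assumes f: "f \<in> carrier (free_module R (tuples V n))"
    and g: "g \<in> carrier (free_module R (tuples V n))"
  shows "tensor_form R V \<beta> n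
      (tensor_kernel R V n +>\<^bsub>free_module R (tuples V n)\<^esub> f)
      (tensor_kernel R V n +>\<^bsub>free_module R (tuples V n)\<^esub> g) = free_form R V \<beta> n f g"
proof -
  let ?F = "free_module R (tuples V n)"
  let ?K = "tensor_kernel R V n"
  interpret F: module R ?F by (rule module_free_module)
  interpret K: abelian_subgroup ?K ?F
    by (rule F.abelian_subgroup_submodule[OF submodule_tensor_kernel])
  have "free_form R V \<beta> n f' g' = free_form R V \<beta> n f g"
    if "f' \<in> ?K +>\<^bsub>?F\<^esub> f" "g' \<in> ?K +>\<^bsub>?F\<^esub> g" for f' g'
  proof -
    obtain u v where u: "u \<in> ?K" "f' = u \<oplus>\<^bsub>?F\<^esub> f" and v: "v \<in> ?K" "g' = v \<oplus>\<^bsub>?F\<^esub> g"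
      using \<open>f' \<in> _\<close> \<open>g' \<in> _\<close> by (auto simp: a_r_coset_def')
    have uv: "u \<in> carrier ?F" "v \<in> carrier ?F"
      using u v tensor_kernel_closed by auto
    then have g': "g' \<in> carrier ?F" using v g by simp
    \<comment> \<open>The representatives are exchanged one argument at a time, first
      \<open>f'\<close> and then \<open>g'\<close>; each differs from the old one by a kernel
      element, which contributes zero.\<close>
    have "free_form R V \<beta> n f' g' = free_form R V \<beta> n f g'"
      using F.functional_add[OF free_form_functional_left[OF g'] uv(1) f]
        free_form_tensor_kernel_left[OF u(1) g'] F.functional_closed[OF free_form_functional_left[OF g'] f]
      by (simp add: u)
    also have "\<dots> = free_form R V \<beta> n f g"
      using F.functional_add[OF free_form_functional_right[OF f] uv(2) g]
        free_form_tensor_kernel_right[OF f v(1)] F.functional_closed[OF free_form_functional_right[OF f] g]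
      by (simp add: v)
    finally show ?thesis .
  qed
  then have "(\<lambda>(f, g). free_form R V \<beta> n f g) ` ((?K +>\<^bsub>?F\<^esub> f) \<times> (?K +>\<^bsub>?F\<^esub> g))
      = (\<lambda>_. free_form R V \<beta> n f g) ` ((?K +>\<^bsub>?F\<^esub> f) \<times> (?K +>\<^bsub>?F\<^esub> g))"
    by (intro image_cong refl) (simp only: mem_Times_iff case_prod_beta)
  \<comment> \<open>The image of a constant map is a singleton only on a nonempty set; the pair
    \<open>(f, g)\<close> lies in the product of the two cosets.\<close>
  also have "\<dots> = {free_form R V \<beta> n f g}"
    by (rule image_constant[where x = "(f, g)"])
      (simp add: K.a_rcos_self[OF f] K.a_rcos_self[OF g])
  finally show ?thesis
    by (simp add: tensor_form_def)
qed

lemma tensor_form_closed: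
  assumes "A \<in> carrier (tensor_power R V n)" and "B \<in> carrier (tensor_power R V n)"
  shows "tensor_form R V \<beta> n A B \<in> carrier R"
proof -
  obtain f where f: "f \<in> carrier (free_module R (tuples V n))"
    "A = tensor_kernel R V n +>\<^bsub>free_module R (tuples V n)\<^esub> f"
    using assms(1) by (rule tensor_power_cases)
  obtain g where g: "g \<in> carrier (free_module R (tuples V n))"
    "B = tensor_kernel R V n +>\<^bsub>free_module R (tuples V n)\<^esub> g"
    using assms(2) by (rule tensor_power_cases)
  show ?thesis
    using f g module.functional_closed[OF module_free_module free_form_functional_right]
    by (simp add: tensor_form_cosets)
qed

lemma tensor_form_add_right:
  assumes "A \<in> carrier (tensor_power R V n)" and "B \<in> carrier (tensor_power R V n)"
    and "C \<in> carrier (tensor_power R V n)"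
  shows "tensor_form R V \<beta> n A (B \<oplus>\<^bsub>tensor_power R V n\<^esub> C)
    = tensor_form R V \<beta> n A B \<oplus> tensor_form R V \<beta> n A C"
proof -
  let ?F = "free_module R (tuples V n)"
  let ?K = "tensor_kernel R V n"
  interpret F: module R ?F by (rule module_free_module)
  obtain f where f: "f \<in> carrier ?F" "A = ?K +>\<^bsub>?F\<^esub> f"
    using assms(1) by (rule tensor_power_cases)
  obtain g where g: "g \<in> carrier ?F" "B = ?K +>\<^bsub>?F\<^esub> g"
    using assms(2) by (rule tensor_power_cases)
  obtain h where h: "h \<in> carrier ?F" "C = ?K +>\<^bsub>?F\<^esub> h"
    using assms(3) by (rule tensor_power_cases)
  \<comment> \<open>Addition in the quotient is the setwise sum, and the setwise sum of two cosets
    is the coset of the sum of representatives.\<close>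
  have "B \<oplus>\<^bsub>tensor_power R V n\<^esub> C = ?K +>\<^bsub>?F\<^esub> (g \<oplus>\<^bsub>?F\<^esub> h)"
    using abelian_subgroup.a_rcos_sum[OF F.abelian_subgroup_submodule[OF submodule_tensor_kernel]] g h
    by (simp add: tensor_power_def quotient_module_def)
  then show ?thesis
    using f g h by (simp add: tensor_form_cosets F.functional_add[OF free_form_functional_right])
qed

end


section \<open>Commutation of shift and phase operators\<close>

theorem proposition3p5:
  fixes R :: "('r, 'x) ring_scheme"
    and V :: "('r, 'v, 'y) module_scheme"
    and \<epsilon> :: "'r \<Rightarrow> complex"
    and \<beta> :: "'v \<Rightarrow> 'v \<Rightarrow> 'r"
    and k n :: nat
  defines "H \<equiv> tensor_power R V n"
    and "\<beta>H \<equiv> tensor_form R V \<beta> n"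
  assumes "frobenius_quantum_data R \<epsilon> V k \<beta>"
    and "n \<ge> 1"
    and "a \<in> carrier H"
    and "b \<in> carrier H"
  shows "\<forall>f \<in> Fun H.
    shift_op H a (phase_op H \<epsilon> \<beta>H b f) =
      (\<lambda>x\<in>carrier H. inverse (\<epsilon> (\<beta>H b a)) * phase_op H \<epsilon> \<beta>H b (shift_op H a f) x)"
proof
  interpret D: frobenius_quantum_data R \<epsilon> V k \<beta> by fact
  interpret bilinear_module R V \<beta>
    using D.perfect by unfold_locales (simp add: perfect_form_def)
  interpret H: abelian_group H
    unfolding H_def by (rule D.abelian_group_tensor_power)
  have \<epsilon>: "additive_character R \<epsilon>"
    using D.generating by (simp add: generating_character_def)
  fix f assume "f \<in> Fun H"
  have "\<epsilon> (\<beta>H b (x \<ominus>\<^bsub>H\<^esub> a)) = inverse (\<epsilon> (\<beta>H b a)) * \<epsilon> (\<beta>H b x)" if x: "x \<in> carrier H" for x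
  proof -
    \<comment> \<open>Additivity gives a formula for sums only, so \<open>x\<close> is split as a
      sum instead of expanding the difference.\<close>
    have "x = (x \<ominus>\<^bsub>H\<^esub> a) \<oplus>\<^bsub>H\<^esub> a"
      using x \<open>a \<in> carrier H\<close> by (simp add: a_minus_def H.a_assoc H.l_neg)
    then have "\<beta>H b x = \<beta>H b (x \<ominus>\<^bsub>H\<^esub> a) \<oplus>\<^bsub>R\<^esub> \<beta>H b a"
      using tensor_form_add_right[of b n "x \<ominus>\<^bsub>H\<^esub> a" a] x \<open>a \<in> carrier H\<close> \<open>b \<in> carrier H\<close> H.minus_closed
      unfolding \<beta>H_def H_def by metis
    moreover have "\<beta>H b (x \<ominus>\<^bsub>H\<^esub> a) \<in> carrier R" "\<beta>H b a \<in> carrier R"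
      using tensor_form_closed x \<open>a \<in> carrier H\<close> \<open>b \<in> carrier H\<close> H.minus_closed
      unfolding \<beta>H_def H_def by metis+
    \<comment> \<open>The character turns the sum into a product, and its values are nonzero, so the
      factor at \<open>a\<close> can be divided out.\<close>
    ultimately show ?thesis
      using \<epsilon> by (simp add: additive_character_def field_simps)
  qed
  \<comment> \<open>Off \<open>carrier H\<close> both sides are \<open>undefined\<close>. On it,
    \<open>x \<ominus> a\<close> is again in the carrier, so the inner restriction unfolds and both
    sides are multiples of the value of \<open>f\<close> at \<open>x \<ominus> a\<close>.\<close>
  then show "shift_op H a (phase_op H \<epsilon> \<beta>H b f) =
      (\<lambda>x\<in>carrier H. inverse (\<epsilon> (\<beta>H b a)) * phase_op H \<epsilon> \<beta>H b (shift_op H a f) x)"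
    using \<open>a \<in> carrier H\<close> by (auto simp: shift_op_def phase_op_def fun_eq_iff)
qed

end
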